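(* Let $n, r \geq 1$. Then \[ \mathcal{S}_{(r,n)}(x) + x^n \mathcal{S}^\star_{(n,r)}(x) = (-1)^r (x-1)^{r+n} \binom{r+n}{r}^{-1} + x^n, \] where $\mathcal{S}^\star_{(n,r)}(x) = x^r \mathcal{S}_{(n,r)}(x^{-1})$.
   Context: For integers $n, r \geq 0$, $\mathcal{S}_{(r,n)}(x) = \sum_{k=0}^{n} \binom{n}{k} (-1)^k x^{n-k} \binom{r+k}{r}^{-1} \in \mathbb{Q}[x]$, a polynomial of degree $n$. Its reciprocal polynomial is $\mathcal{S}^\star_{(r,n)}(x) = x^n \mathcal{S}_{(r,n)}(x^{-1})$. *)

theory Defs
  imports Complex_Main "HOL-Computational_Algebra.Polynomial"
begin

definition S_poly :: "nat \<Rightarrow> nat \<Rightarrow> rat poly" where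
  "S_poly r n =
     (\<Sum>k=0..n. monom (of_nat (n choose k) * (- 1) ^ k * inverse (of_nat ((r + k) choose r))) (n - k))"

(* reflect_poly reverses coefficients with respect to the actual degree; the lemmas
   degree_S_poly and poly_S_star_poly show that here this is x^n * S(1/x). *)
definition S_star_poly :: "nat \<Rightarrow> nat \<Rightarrow> rat poly" where
  "S_star_poly r n = reflect_poly (S_poly r n)"

lemma coeff_S_poly_top: "coeff (S_poly r n) n = 1"
proof -
  have "coeff (S_poly r n) n =
      (\<Sum>k=0..n. if k = 0 then of_nat (n choose k) * (- 1) ^ k * inverse (of_nat ((r + k) choose r)) else 0)"
    unfolding S_poly_def coeff_sum coeff_monom by (intro sum.cong) auto
  then show ?thesis by simp
qed

lemma degree_S_poly: "degree (S_poly r n) = n"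
proof (rule antisym)
  show "degree (S_poly r n) \<le> n"
    unfolding S_poly_def
    by (intro degree_sum_le) (auto intro: order_trans[OF degree_monom_le])
  show "n \<le> degree (S_poly r n)"
    by (rule le_degree) (simp add: coeff_S_poly_top)
qed

lemma poly_S_star_poly:
  "x \<noteq> 0 \<Longrightarrow> poly (S_star_poly r n) x = x ^ n * poly (S_poly r n) (inverse x)"
  by (simp add: S_star_poly_def poly_reflect_poly_nz degree_S_poly)

end

theory Submission
  imports Defs
begin

text \<open>
  Since (n choose k) / (r + k choose r) = (r + n choose r + k) / (r + n choose r), the two summands
  are, up to the common factor, the terms of degree at most n and the terms of degree at least n
  in the binomial expansion of (x - 1)^(r + n).  The term of degree n, which is x^n, occurs in both.
\<close>

text \<open>Both sides equal n! r! / (j! (r + n - j)!).\<close>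

lemma choose_div_choose:
  fixes n r j :: nat
  assumes "j \<le> n"
  shows "of_nat (n choose j) * inverse (of_nat ((r + (n - j)) choose r)) =
         of_nat ((r + n) choose j) * inverse (of_nat ((r + n) choose r) :: 'a::field_char_0)"
  using assms by (simp add: binomial_fact divide_simps)

lemma coeff_S_poly:
  "coeff (S_poly r n) j =
     (if j \<le> n then (- 1) ^ (n - j) * of_nat ((r + n) choose j) * inverse (of_nat ((r + n) choose r))
      else 0)"
proof -
  let ?c = "\<lambda>k. of_nat (n choose k) * (- 1) ^ k * inverse (of_nat ((r + k) choose r)) :: rat"
  \<comment> \<open>Only k = n - j hits degree j; the guard \<open>j \<le> n\<close> is there
    because \<open>n - j\<close> truncates to 0 for larger j.\<close>
  have "coeff (S_poly r n) j = (\<Sum>k=0..n. if k = n - j \<and> j \<le> n then ?c k else 0)"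
    unfolding S_poly_def coeff_sum coeff_monom by (intro sum.cong) auto
  also have "\<dots> = (if j \<le> n then ?c (n - j) else 0)"
    by simp
  finally show ?thesis
    using choose_div_choose[of j n r, where 'a = rat]
    by (simp add: binomial_symmetric[of j n, symmetric] mult_ac)
qed

text \<open>Reversal picks the coefficient of \<open>S_poly n r\<close> at r - k, and r - k and n +
  k are complementary in r + n.\<close>

lemma coeff_S_star_poly:
  "coeff (S_star_poly n r) k =
     (if k \<le> r then (- 1) ^ k * of_nat ((r + n) choose (n + k)) * inverse (of_nat ((r + n) choose r))
      else 0)"
  using binomial_symmetric[of "r - k" "n + r"] binomial_symmetric[of n "n + r"]
  by (simp add: S_star_poly_def coeff_reflect_poly degree_S_poly coeff_S_poly add.commute)

theorem theorem2p5:
  fixes n r :: nat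
  assumes "n \<ge> 1" and "r \<ge> 1"
  shows "S_poly r n + monom 1 n * S_star_poly n r =
         smult ((- 1) ^ r * inverse (of_nat ((r + n) choose r))) ([:- 1, 1:] ^ (r + n)) + monom 1 n"
proof (rule poly_eqI)
  fix j
  have rhs: "coeff ([:- 1, 1:] ^ (r + n) :: rat poly) i =
      (if i \<le> r + n then of_nat ((r + n) choose i) * (- 1) ^ (r + n - i) else 0)" for i
    by (auto simp: coeff_linear_poly_power coeff_eq_0 degree_linear_power)
  consider "j < n" | "j = n" | k where "j = n + k" "0 < k"
    by (metis less_imp_add_positive linorder_neqE_nat)
  then show "coeff (S_poly r n + monom 1 n * S_star_poly n r) j =
      coeff (smult ((- 1) ^ r * inverse (of_nat ((r + n) choose r))) ([:- 1, 1:] ^ (r + n)) + monom 1 n) j"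
  proof cases
    case 1
    then have "(- 1) ^ r * (- 1) ^ (r + n - j) = ((- 1) ^ (n - j) :: rat)"
      by (simp add: minus_one_power_iff)
    with 1 show ?thesis
      by (simp add: rhs coeff_S_poly coeff_monom_mult)
  next
    case 2
    then show ?thesis
      \<comment> \<open>The binomials cancel, so both sides are 1 + 1.\<close>
      using binomial_symmetric[of r "r + n"]
      by (simp add: rhs coeff_S_poly coeff_S_star_poly coeff_monom_mult minus_one_power_iff)
  next
    case (3 k)
    \<comment> \<open>For k > r both sides have coefficient 0, so the sign matters only for
      \<open>k \<le> r\<close>.\<close>
    then have "(- 1) ^ r * (- 1) ^ (r - k) = ((- 1) ^ k :: rat)" if "k \<le> r"
      using that by (simp add: minus_one_power_iff)
    with 3 show ?thesis
      by (simp add: rhs coeff_S_poly coeff_S_star_poly coeff_monom_mult)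
  qed
qed

end
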